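(* Let $n \ge m > 1$ be integers and let $A$ be an $n\times n$ matrix with all entries in $\{+1,-1\}$. Let $E(\det(M)^2)$ denote the mean value of $\det(M)^2$ taken over all $m\times m$ submatrices $M$ of $A$. Then $$E(\det(M)^2) \le n^m\Big/\binom{n}{m}.$$ Moreover, equality holds if and only if $A$ is a Hadamard matrix.
   Context: An $m\times m$ submatrix of $A$ is obtained by choosing $m$ of the rows and $m$ of the columns of $A$ (not necessarily consecutive). Submatrices are indexed by the choice of rows and columns, so there are exactly $\binom{n}{m}^2$ of them, and the mean is the uniform average over these $\binom{n}{m}^2$ choices. A Hadamard matrix of order $n$ is an $n\times n$ matrix $H$ with entries in $\{+1,-1\}$ satisfying $HH^T = nI$. *)

theory Defs
  imports Complex_Main
    "Jordan_Normal_Form.Determinant"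
    "Jordan_Normal_Form.DL_Submatrix"
begin

definition sign_matrix :: "nat \<Rightarrow> real mat \<Rightarrow> bool" where
  "sign_matrix n A \<longleftrightarrow>
     A \<in> carrier_mat n n \<and> (\<forall>i<n. \<forall>j<n. A $$ (i, j) \<in> {1, -1})"

definition hadamard_matrix :: "nat \<Rightarrow> real mat \<Rightarrow> bool" where
  "hadamard_matrix n H \<longleftrightarrow>
     sign_matrix n H \<and> H * transpose_mat H = real n \<cdot>\<^sub>m 1\<^sub>m n"

text \<open>Submatrices are indexed by pairs of a row set and a column set, so equal matrices arising
  from different choices of rows and columns are counted separately.\<close>

definition submatrix_indices :: "nat \<Rightarrow> nat \<Rightarrow> (nat set \<times> nat set) set" where
  "submatrix_indices n m =
     {I. I \<subseteq> {..<n} \<and> card I = m} \<times> {J. J \<subseteq> {..<n} \<and> card J = m}"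

definition mean_det_squared :: "nat \<Rightarrow> nat \<Rightarrow> real mat \<Rightarrow> real" where
  "mean_det_squared n m A =
     (\<Sum>(I, J)\<in>submatrix_indices n m. (det (submatrix A I J))\<^sup>2)
       / real (card (submatrix_indices n m))"

lemma card_submatrix_indices: "card (submatrix_indices n m) = (n choose m)\<^sup>2"
  using n_subsets[of "{..<n}" m]
  by (simp add: submatrix_indices_def card_cartesian_product power2_eq_square)

lemma submatrix_carrier:
  assumes "A \<in> carrier_mat n n" and "(I, J) \<in> submatrix_indices n m"
  shows "submatrix A I J \<in> carrier_mat m m"
proof -
  have "{i. i < n \<and> i \<in> I} = I" and "{j. j < n \<and> j \<in> J} = J"
    using assms(2) by (auto simp: submatrix_indices_def)
  with assms show ?thesis
    by (auto simp: submatrix_indices_def dim_submatrix)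
qed

end

theory Submission
  imports Defs
begin

text \<open>By the Cauchy--Binet formula the squared minors of \<open>A\<close> with row set \<open>I\<close> add up to the Gram
  determinant of these \<open>m\<close> rows. A Gram matrix is positive semidefinite and here its diagonal entries
  are all \<open>n\<close>, so by Hadamard's inequality the determinant is at most \<open>n ^ m\<close>, with equality only if
  the rows are pairwise orthogonal. Averaging over \<open>I\<close> gives the bound; since \<open>m \<ge> 2\<close>, any two rows
  occur in a common \<open>I\<close>, so equality means that all rows of \<open>A\<close> are orthogonal.\<close>

section \<open>The Cauchy--Binet formula\<close>

text \<open>Fixing the maps to be the identity outside \<open>{0..<m}\<close> matches the index set
  of \<open>det_linear_rows_sum\<close> and keeps the set finite for finite
  \<open>S\<close>.\<close>

abbreviation maps_to :: "nat \<Rightarrow> nat set \<Rightarrow> (nat \<Rightarrow> nat) set" where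
  "maps_to m S \<equiv> {f. (\<forall>i\<in>{0..<m}. f i \<in> S) \<and> (\<forall>i. i \<notin> {0..<m} \<longrightarrow> f i = i)}"

text \<open>Each row is a combination of rows of \<open>B\<close>, so multilinearity expands the
  determinant over all choice maps; a repeated choice gives dependent rows. The set \<open>S\<close>
  stays general because both \<open>{..<n}\<close> and a single column set \<open>J\<close> are
  needed.\<close>

lemma det_sum_products_injective:
  fixes A B :: "'a :: comm_ring_1 mat"
  assumes A: "A \<in> carrier_mat m n" and B: "B \<in> carrier_mat n m" and S: "S \<subseteq> {..<n}"
  shows "det (mat m m (\<lambda>(i, j). \<Sum>k\<in>S. A $$ (i, k) * B $$ (k, j))) =
    (\<Sum>f\<in>{f \<in> maps_to m S. inj_on f {0..<m}}.
       det (mat\<^sub>r m m (\<lambda>i. A $$ (i, f i) \<cdot>\<^sub>v row B (f i))))"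
proof -
  have fS: "finite S" using S finite_subset by blast
  let ?g = "\<lambda>f. det (mat\<^sub>r m m (\<lambda>i. A $$ (i, f i) \<cdot>\<^sub>v row B (f i)))"
  have "mat m m (\<lambda>(i, j). \<Sum>k\<in>S. A $$ (i, k) * B $$ (k, j)) =
      mat\<^sub>r m m (\<lambda>i. finsum_vec TYPE('a) m (\<lambda>k. A $$ (i, k) \<cdot>\<^sub>v row B k) S)"
    using A B S fS
    by (intro eq_matI) (auto simp: subset_iff index_finsum_vec[OF fS] Pi_iff carrier_dim_vec
      intro!: sum.cong)
  then have "det (mat m m (\<lambda>(i, j). \<Sum>k\<in>S. A $$ (i, k) * B $$ (k, j))) = sum ?g (maps_to m S)"
    using B by (simp only:, subst det_linear_rows_sum[OF fS]) auto
  also have "\<dots> = sum ?g {f \<in> maps_to m S. inj_on f {0..<m}}"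
  proof (rule sum.mono_neutral_right)
    show "finite (maps_to m S)" by (rule finite_bounded_functions[OF fS]) simp
    show "\<forall>f\<in>maps_to m S - {f \<in> maps_to m S. inj_on f {0..<m}}. ?g f = 0"
    proof
      fix f assume "f \<in> maps_to m S - {f \<in> maps_to m S. inj_on f {0..<m}}"
      then obtain i j where ij: "i < m" "j < m" "i \<noteq> j" "f i = f j"
        by (auto simp: inj_on_def)
      \<comment> \<open>The scaled rows need not coincide, only the unscaled ones;
        \<open>det_rows_mul\<close> then pulls the scalars out.\<close>
      have "det (mat\<^sub>r m m (\<lambda>i. row B (f i))) = 0"
        by (rule det_identical_rows[OF _ ij(3) ij(1) ij(2)]) (use ij in auto)
      then show "?g f = 0"
        using B by (subst det_rows_mul) auto
    qed
  qed auto
  finally show ?thesis .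
qed

lemma bij_betw_pick:
  assumes "finite J"
  shows "bij_betw (pick J) {..<card J} J"
proof (rule bij_betw_imageI)
  show inj: "inj_on (pick J) {..<card J}"
    by (rule inj_onI) (metis card_pick_le lessThan_iff)
  have "pick J ` {..<card J} \<subseteq> J"
    by (auto simp: pick_in_set_le)
  then show "pick J ` {..<card J} = J"
    using assms inj by (simp add: card_image card_subset_eq)
qed

text \<open>Reindexing by \<open>pick J\<close> brings this product into the shape of
  \<open>det_sum_products_injective\<close> with \<open>S = J\<close>.\<close>

lemma submatrix_mult_submatrix:
  fixes A B :: "'a :: comm_ring_1 mat"
  assumes A: "A \<in> carrier_mat m n" and B: "B \<in> carrier_mat n m" and J: "J \<subseteq> {..<n}"
  shows "submatrix A UNIV J * submatrix B J UNIV =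
    mat m m (\<lambda>(i, j). \<Sum>k\<in>J. A $$ (i, k) * B $$ (k, j))"
proof (rule eq_matI)
  have fJ: "finite J" using J finite_subset by blast
  have J': "{k. k < n \<and> k \<in> J} = J" using J by auto
  fix i j
  assume "i < dim_row (mat m m (\<lambda>(i, j). \<Sum>k\<in>J. A $$ (i, k) * B $$ (k, j)))"
    and "j < dim_col (mat m m (\<lambda>(i, j). \<Sum>k\<in>J. A $$ (i, k) * B $$ (k, j)))"
  then have ij: "i < m" "j < m" by auto
  have "(submatrix A UNIV J * submatrix B J UNIV) $$ (i, j) =
      (\<Sum>k<card J. A $$ (i, pick J k) * B $$ (pick J k, j))"
    using ij A B J'
    by (auto simp: submatrix_def scalar_prod_def pick_UNIV lessThan_atLeast0 intro!: sum.cong)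
  also have "\<dots> = (\<Sum>k\<in>J. A $$ (i, k) * B $$ (k, j))"
    by (rule sum.reindex_bij_betw[OF bij_betw_pick[OF fJ]])
  finally show "(submatrix A UNIV J * submatrix B J UNIV) $$ (i, j) =
      mat m m (\<lambda>(i, j). \<Sum>k\<in>J. A $$ (i, k) * B $$ (k, j)) $$ (i, j)"
    using ij by simp
qed (use A B in \<open>auto simp: dim_submatrix\<close>)

text \<open>Both \<open>det (A * B)\<close> and \<open>det (submatrix A UNIV J * submatrix B J UNIV)\<close> are sums of the same terms
  over injective index maps, into \<open>{..<n}\<close> and \<open>J\<close> respectively; so it is enough to sort the
  maps by their image.\<close>
theorem cauchy_binet:
  fixes A B :: "'a :: comm_ring_1 mat"
  assumes A: "A \<in> carrier_mat m n" and B: "B \<in> carrier_mat n m"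
  shows "det (A * B) = (\<Sum>J | J \<subseteq> {..<n} \<and> card J = m.
    det (submatrix A UNIV J) * det (submatrix B J UNIV))"
proof -
  let ?g = "\<lambda>f. det (mat\<^sub>r m m (\<lambda>i. A $$ (i, f i) \<cdot>\<^sub>v row B (f i)))"
  let ?F = "\<lambda>S. {f \<in> maps_to m S. inj_on f {0..<m}}"
  let ?Js = "{J. J \<subseteq> {..<n} \<and> card J = m}"
  have fin: "finite (?F {..<n})"
    by (rule finite_subset[OF _ finite_bounded_functions[of "{..<n}" "{0..<m}"]]) auto
  have "A * B = mat m m (\<lambda>(i, j). \<Sum>k\<in>{..<n}. A $$ (i, k) * B $$ (k, j))"
    using A B by (intro eq_matI) (auto simp: scalar_prod_def lessThan_atLeast0 intro!: sum.cong)
  then have "det (A * B) = sum ?g (?F {..<n})"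
    using det_sum_products_injective[OF A B order_refl] by simp
  also have "\<dots> = (\<Sum>J\<in>?Js. sum ?g {f \<in> ?F {..<n}. f ` {0..<m} = J})"
    by (rule sum.group[symmetric]) (use fin in \<open>auto simp: card_image\<close>)
  also have "\<dots> = (\<Sum>J\<in>?Js. det (submatrix A UNIV J) * det (submatrix B J UNIV))"
  proof (rule sum.cong[OF refl])
    fix J assume "J \<in> ?Js"
    then have J: "J \<subseteq> {..<n}" "card J = m" by auto
    have fJ: "finite J" using J(1) finite_subset by blast
    have J': "{k. k < n \<and> k \<in> J} = J" using J by auto
    \<comment> \<open>An injective map from \<open>m\<close> indices into a set of size
      \<open>m\<close> is onto, so the fibre over \<open>J\<close> consists of all injective maps
      into \<open>J\<close>.\<close>
    have "f ` {0..<m} = J" if "f \<in> ?F J" for f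
      using that J fJ by (intro card_subset_eq) (auto simp: card_image)
    then have "{f \<in> ?F {..<n}. f ` {0..<m} = J} = ?F J"
      using J(1) by blast
    then have "sum ?g {f \<in> ?F {..<n}. f ` {0..<m} = J} =
        det (submatrix A UNIV J * submatrix B J UNIV)"
      using det_sum_products_injective[OF A B J(1)] submatrix_mult_submatrix[OF A B J(1)] by simp
    also have "\<dots> = det (submatrix A UNIV J) * det (submatrix B J UNIV)"
      by (rule det_mult[of _ m]) (use A B J J' in \<open>auto simp: dim_submatrix\<close>)
    finally show "sum ?g {f \<in> ?F {..<n}. f ` {0..<m} = J} =
        det (submatrix A UNIV J) * det (submatrix B J UNIV)" .
  qed
  finally show ?thesis .
qed

section \<open>Hadamard's inequality for positive semidefinite matrices\<close>

text \<open>The entries are given by a function, so that the leading \<open>m \<times> m\<close> block of a matrix is obtained by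
  lowering the dimension only.\<close>
definition pos_semidef :: "nat \<Rightarrow> (nat \<Rightarrow> nat \<Rightarrow> real) \<Rightarrow> bool" where
  "pos_semidef m g \<longleftrightarrow> (\<forall>i<m. \<forall>j<m. g i j = g j i) \<and>
     (\<forall>x. 0 \<le> (\<Sum>i<m. x i * (\<Sum>j<m. g i j * x j)))"

lemma pos_semidef_nonneg:
  "pos_semidef m g \<Longrightarrow> 0 \<le> (\<Sum>i<m. x i * (\<Sum>j<m. g i j * x j))"
  by (simp add: pos_semidef_def)

lemma pos_semidef_Suc:
  assumes "pos_semidef (Suc m) g"
  shows "pos_semidef m g"
  unfolding pos_semidef_def
proof (intro conjI allI impI)
  fix x
  let ?y = "\<lambda>i. if i < m then x i else 0 :: real"
  have "0 \<le> (\<Sum>i<Suc m. ?y i * (\<Sum>j<Suc m. g i j * ?y j))"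
    by (rule pos_semidef_nonneg[OF assms])
  also have "\<dots> = (\<Sum>i<m. x i * (\<Sum>j<m. g i j * x j))"
    by (simp cong: sum.cong_simp)
  finally show "0 \<le> (\<Sum>i<m. x i * (\<Sum>j<m. g i j * x j))" .
qed (use assms in \<open>auto simp: pos_semidef_def\<close>)

lemma pos_semidef_diag_nonneg:
  assumes psd: "pos_semidef m g" and i: "i < m"
  shows "0 \<le> g i i"
proof -
  have "0 \<le> (\<Sum>k<m. of_bool (k = i) * (\<Sum>j<m. g k j * of_bool (j = i)))"
    by (rule pos_semidef_nonneg[OF psd])
  also have "\<dots> = g i i"
    using i by (simp add: of_bool_def if_distrib[of "\<lambda>x. _ * x"] if_distrib[of "\<lambda>x. x * _"]
        sum.delta cong: if_cong)
  finally show ?thesis .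
qed

text \<open>A zero of the form is a minimum, so the gradient vanishes there: along
  \<open>t * x\<close> plus the \<open>i\<close>-th unit vector the form is affine in
  \<open>t\<close> with slope \<open>2 * a\<close>, and stays nonnegative only if
  \<open>a = 0\<close>.\<close>

lemma pos_semidef_kernel:
  assumes psd: "pos_semidef m g" and x: "(\<Sum>i<m. x i * (\<Sum>j<m. g i j * x j)) = 0" and i: "i < m"
  shows "(\<Sum>j<m. g i j * x j) = 0"
proof (rule ccontr)
  define a where "a = (\<Sum>j<m. g i j * x j)"
  assume "(\<Sum>j<m. g i j * x j) \<noteq> 0"
  then have a: "a \<noteq> 0" by (simp add: a_def)
  have sym: "(\<Sum>k<m. x k * g k i) = a"
    unfolding a_def using psd i by (auto simp: pos_semidef_def intro!: sum.cong)
  have nonneg: "0 \<le> 2 * t * a + g i i" for t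
  proof -
    define z where "z k = t * x k + of_bool (k = i)" for k
    have 1: "(\<Sum>j<m. g k j * z j) = t * (\<Sum>j<m. g k j * x j) + g k i" for k
      using i by (simp add: z_def distrib_left sum.distrib sum_distrib_left of_bool_def mult.left_commute
          if_distrib[of "\<lambda>x. _ * x"] sum.delta cong: if_cong)
    have "0 \<le> (\<Sum>k<m. z k * (\<Sum>j<m. g k j * z j))"
      by (rule pos_semidef_nonneg[OF psd])
    also have "\<dots> = (\<Sum>k<m. t * t * (x k * (\<Sum>j<m. g k j * x j))) + (\<Sum>k<m. t * (x k * g k i))
        + (\<Sum>k<m. of_bool (k = i) * (t * (\<Sum>j<m. g k j * x j) + g k i))"
      unfolding 1 sum.distrib[symmetric] by (rule sum.cong) (auto simp: z_def algebra_simps)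
    also have "\<dots> = t * t * 0 + t * a + (t * a + g i i)"
      using i by (simp add: sum_distrib_left[symmetric] x sym a_def of_bool_def
          if_distrib[of "\<lambda>x. x * _"] sum.delta cong: if_cong)
    finally show ?thesis by (simp add: mult_ac)
  qed
  \<comment> \<open>This \<open>t\<close> gives the affine function the value
    \<open>-1\<close>.\<close>
  from nonneg[of "- (g i i + 1) / (2 * a)"] a show False
    by (simp add: field_simps)
qed

section \<open>Linear systems and the Schur complement\<close>

lemma det_eq_0_if_kernel:
  fixes g :: "nat \<Rightarrow> nat \<Rightarrow> 'a :: idom"
  assumes "\<And>i. i < m \<Longrightarrow> (\<Sum>j<m. g i j * x j) = 0" and "k < m" and "x k \<noteq> 0"
  shows "det (mat m m (\<lambda>(i, j). g i j)) = 0"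
proof -
  have "vec m x \<noteq> 0\<^sub>v m"
    using assms(2,3) by (metis index_vec index_zero_vec(1))
  moreover have "mat m m (\<lambda>(i, j). g i j) *\<^sub>v vec m x = 0\<^sub>v m"
    using assms(1) by (intro eq_vecI) (auto simp: scalar_prod_def lessThan_atLeast0)
  ultimately show ?thesis
    by (subst det_0_iff_vec_prod_zero[of _ m]) (auto intro!: exI[of _ "vec m x"])
qed

lemma kernel_if_det_eq_0:
  fixes g :: "nat \<Rightarrow> nat \<Rightarrow> 'a :: idom"
  assumes "det (mat m m (\<lambda>(i, j). g i j)) = 0"
  obtains x k where "\<And>i. i < m \<Longrightarrow> (\<Sum>j<m. g i j * x j) = 0" and "k < m" and "x k \<noteq> 0"
proof -
  let ?G = "mat m m (\<lambda>(i, j). g i j)"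
  obtain v where v: "v \<in> carrier_vec m" "v \<noteq> 0\<^sub>v m" "?G *\<^sub>v v = 0\<^sub>v m"
    using assms det_0_iff_vec_prod_zero[of ?G m] by auto
  obtain k where "k < m" "v $ k \<noteq> 0"
    using v(1,2) by (metis carrier_vecD eq_vecI index_zero_vec)
  moreover have "(\<Sum>j<m. g i j * v $ j) = 0" if "i < m" for i
    using arg_cong[OF v(3), of "\<lambda>w. w $ i"] that v(1)
    by (simp add: scalar_prod_def lessThan_atLeast0)
  ultimately show ?thesis using that by blast
qed

lemma solution_if_det_neq_0:
  fixes g :: "nat \<Rightarrow> nat \<Rightarrow> 'a :: field"
  assumes "det (mat m m (\<lambda>(i, j). g i j)) \<noteq> 0"
  obtains x where "\<And>i. i < m \<Longrightarrow> (\<Sum>j<m. g i j * x j) = b i"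
proof -
  let ?G = "mat m m (\<lambda>(i, j). g i j)"
  have "?G \<in> Units (ring_mat TYPE('a) m ())"
    by (rule det_non_zero_imp_unit[OF _ assms]) simp
  then obtain H where H: "H \<in> carrier_mat m m" "?G * H = 1\<^sub>m m"
    unfolding Units_def ring_mat_def by auto
  define v where "v = H *\<^sub>v vec m b"
  have v: "v \<in> carrier_vec m" using H by (simp add: v_def)
  have "?G *\<^sub>v v = vec m b"
    unfolding v_def using H by (subst assoc_mult_mat_vec[symmetric, of _ m m _ m]) auto
  then have "(?G *\<^sub>v v) $ i = b i" if "i < m" for i
    using that by simp
  then have "(\<Sum>j<m. g i j * v $ j) = b i" if "i < m" for i
    using that v by (simp add: scalar_prod_def lessThan_atLeast0)
  then show ?thesis using that by blast
qed

text \<open>Subtracting the combination \<open>x\<close> of the first \<open>m\<close> columns from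
  the last one clears it except for the corner entry.\<close>

lemma det_Suc_Schur_complement:
  fixes g :: "nat \<Rightarrow> nat \<Rightarrow> real"
  assumes x: "\<And>i. i < m \<Longrightarrow> (\<Sum>j<m. g i j * x j) = g i m"
  shows "det (mat (Suc m) (Suc m) (\<lambda>(i, j). g i j)) =
    det (mat m m (\<lambda>(i, j). g i j)) * (g m m - (\<Sum>j<m. g m j * x j))"
proof -
  let ?G = "mat (Suc m) (Suc m) (\<lambda>(i, j). g i j)"
  let ?c = "g m m - (\<Sum>j<m. g m j * x j)"
  \<comment> \<open>\<open>T\<close> encodes this column operation: it is unit upper triangular with
    \<open>- x\<close> above the corner.\<close>
  define T where "T = mat (Suc m) (Suc m)
    (\<lambda>(i, j). if j < m then of_bool (i = j) else if i < m then - x i else 1)"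
  have T: "T \<in> carrier_mat (Suc m) (Suc m)" by (simp add: T_def)
  have "det T = (\<Prod>i<Suc m. T $$ (i, i))"
    using det_upper_triangular[OF _ T] T
    by (auto simp: T_def upper_triangular_def prod_list_diag_prod lessThan_atLeast0)
  also have "\<dots> = 1" by (rule prod.neutral) (auto simp: T_def)
  finally have detT: "det T = 1" .
  define L where "L = mat (Suc m) (Suc m)
    (\<lambda>(i, j). if j < m then g i j else if i < m then 0 else ?c)"
  have L: "L \<in> carrier_mat (Suc m) (Suc m)" by (simp add: L_def)
  have "?G * T = L"
  proof (rule eq_matI)
    fix i j assume "i < dim_row L" "j < dim_col L"
    then have ij: "i < Suc m" "j < Suc m" by (auto simp: L_def)
    then have "(?G * T) $$ (i, j) = (\<Sum>k<Suc m. g i k * T $$ (k, j))"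
      by (simp add: T_def scalar_prod_def lessThan_atLeast0)
    also have "\<dots> = L $$ (i, j)"
    proof (cases "j < m")
      case True
      then have "(\<Sum>k<Suc m. g i k * T $$ (k, j)) = (\<Sum>k<Suc m. if k = j then g i k else 0)"
        using ij by (intro sum.cong) (auto simp: T_def)
      then show ?thesis using True ij by (simp add: L_def)
    next
      case False
      then have j: "j = m" using ij by simp
      have "(\<Sum>k<Suc m. g i k * T $$ (k, j)) = g i m - (\<Sum>k<m. g i k * x k)"
        by (simp add: j T_def sum_negf)
      then show ?thesis using ij x[of i] by (auto simp: L_def j less_Suc_eq)
    qed
    finally show "(?G * T) $$ (i, j) = L $$ (i, j)" .
  qed (auto simp: T_def L_def)
  then have "det ?G = det L"
    using det_mult[of ?G "Suc m" T] T detT by simp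
  also have "\<dots> = (\<Sum>i<Suc m. L $$ (i, m) * cofactor L i m)"
    using laplace_expansion_column[OF L, of m] by simp
  also have "\<dots> = ?c * cofactor L m m"
    by (simp add: L_def)
  also have "cofactor L m m = det (mat_delete L m m)"
    by (simp add: cofactor_def)
  also have "mat_delete L m m = mat m m (\<lambda>(i, j). g i j)"
    by (rule eq_matI) (auto simp: L_def mat_delete_def)
  finally show ?thesis by (simp add: mult.commute)
qed

text \<open>If the leading block is regular, the Schur complement is \<open>g m m\<close> minus a value of the quadratic
  form of the leading block, and is itself a value of the whole form; otherwise a kernel
  vector of the leading block is also one of the whole matrix.\<close>
lemma det_Suc_pos_semidef_cases:
  assumes psd: "pos_semidef (Suc m) g"
  obtains (singular) "det (mat (Suc m) (Suc m) (\<lambda>(i, j). g i j)) = 0"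
  | (regular) x where "\<And>i. i < m \<Longrightarrow> (\<Sum>j<m. g i j * x j) = g i m"
    and "det (mat (Suc m) (Suc m) (\<lambda>(i, j). g i j)) =
      det (mat m m (\<lambda>(i, j). g i j)) * (g m m - (\<Sum>i<m. x i * (\<Sum>j<m. g i j * x j)))"
    and "(\<Sum>i<m. x i * (\<Sum>j<m. g i j * x j)) \<le> g m m"
proof (cases "det (mat m m (\<lambda>(i, j). g i j)) = 0")
  case True
  then obtain x k where x: "\<And>i. i < m \<Longrightarrow> (\<Sum>j<m. g i j * x j) = 0" "k < m" "x k \<noteq> 0"
    by (rule kernel_if_det_eq_0) blast
  let ?y = "\<lambda>i. if i < m then x i else 0 :: real"
  have "(\<Sum>i<Suc m. ?y i * (\<Sum>j<Suc m. g i j * ?y j)) = 0"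
    using x(1) by (simp cong: sum.cong_simp)
  then have "(\<Sum>j<Suc m. g i j * ?y j) = 0" if "i < Suc m" for i
    using pos_semidef_kernel[OF psd _ that, of ?y] by blast
  then have "det (mat (Suc m) (Suc m) (\<lambda>(i, j). g i j)) = 0"
    by (rule det_eq_0_if_kernel[of _ g ?y k]) (use x in auto)
  then show ?thesis by (rule singular)
next
  case False
  then obtain x where x: "\<And>i. i < m \<Longrightarrow> (\<Sum>j<m. g i j * x j) = g i m"
    by (rule solution_if_det_neq_0[where b = "\<lambda>i. g i m"]) blast
  have sym: "g i m = g m i" if "i < m" for i
    using psd that by (auto simp: pos_semidef_def)
  have q: "(\<Sum>i<m. x i * (\<Sum>j<m. g i j * x j)) = (\<Sum>j<m. g m j * x j)"
    by (rule sum.cong) (simp_all add: x sym mult.commute[of "x _"])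
  \<comment> \<open>With last coordinate \<open>- 1\<close> the first \<open>m\<close> rows of the
    system cancel, so only row \<open>m\<close> contributes to the form.\<close>
  let ?y = "\<lambda>i. if i < m then x i else - 1"
  have "0 \<le> (\<Sum>i<Suc m. ?y i * (\<Sum>j<Suc m. g i j * ?y j))"
    by (rule pos_semidef_nonneg[OF psd])
  also have "\<dots> = g m m - (\<Sum>j<m. g m j * x j)"
    by (simp add: x sum_negf cong: sum.cong_simp)
  finally show ?thesis
    using det_Suc_Schur_complement[OF x] by (intro regular[OF x]) (simp_all add: q)
qed

text \<open>By induction on \<open>m\<close>: in the regular case the new factor is the Schur
  complement, which lies between \<open>0\<close> and \<open>g m m\<close>. Both bounds are proved
  together because the upper one needs the sign of the smaller determinant.\<close>

lemma det_pos_semidef_bounds: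
  assumes "pos_semidef m g"
  shows "0 \<le> det (mat m m (\<lambda>(i, j). g i j))"
    and "det (mat m m (\<lambda>(i, j). g i j)) \<le> (\<Prod>i<m. g i i)"
proof -
  have "0 \<le> det (mat m m (\<lambda>(i, j). g i j)) \<and> det (mat m m (\<lambda>(i, j). g i j)) \<le> (\<Prod>i<m. g i i)"
    using assms
  proof (induction m)
    case 0
    then show ?case by simp
  next
    case (Suc m)
    note psd = pos_semidef_Suc[OF Suc.prems]
    have diag: "0 \<le> g i i" if "i < Suc m" for i
      using pos_semidef_diag_nonneg[OF Suc.prems that] .
    from Suc.prems show ?case
    proof (cases rule: det_Suc_pos_semidef_cases)
      case singular
      moreover have "0 \<le> (\<Prod>i<Suc m. g i i)"
        using diag by (intro prod_nonneg) auto
      ultimately show ?thesis by simp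
    next
      case (regular x)
      have "0 \<le> (\<Sum>i<m. x i * (\<Sum>j<m. g i j * x j))"
        by (rule pos_semidef_nonneg[OF psd])
      then have "det (mat m m (\<lambda>(i, j). g i j)) *
          (g m m - (\<Sum>i<m. x i * (\<Sum>j<m. g i j * x j))) \<le> (\<Prod>i<m. g i i) * g m m"
        using regular(3) Suc.IH[OF psd] diag by (intro mult_mono prod_nonneg) auto
      then show ?thesis
        using regular(2,3) Suc.IH[OF psd] by simp
    qed
  qed
  then show "0 \<le> det (mat m m (\<lambda>(i, j). g i j))"
    and "det (mat m m (\<lambda>(i, j). g i j)) \<le> (\<Prod>i<m. g i i)" by auto
qed

text \<open>Equality forces equality for the leading block and a Schur complement equal to
  \<open>g m m\<close>, so the quadratic form vanishes at \<open>x\<close>.\<close>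

lemma det_pos_semidef_eq_prod_diag:
  assumes "pos_semidef m g" and "\<And>i. i < m \<Longrightarrow> 0 < g i i"
    and "det (mat m m (\<lambda>(i, j). g i j)) = (\<Prod>i<m. g i i)"
    and "i < m" "j < m" "i \<noteq> j"
  shows "g i j = 0"
  using assms
proof (induction m arbitrary: i j)
  case 0
  then show ?case by simp
next
  case (Suc m)
  note psd = pos_semidef_Suc[OF Suc.prems(1)]
  have pos: "0 < (\<Prod>i<k. g i i)" if "k \<le> Suc m" for k
    using Suc.prems(2) that by (intro prod_pos) auto
  from Suc.prems(1) show ?case
  proof (cases rule: det_Suc_pos_semidef_cases)
    case singular
    then show ?thesis using Suc.prems(3) pos[OF order_refl] by (metis less_irrefl)
  next
    case (regular x)
    let ?D = "det (mat m m (\<lambda>(i, j). g i j))"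
    let ?q = "\<Sum>i<m. x i * (\<Sum>j<m. g i j * x j)"
    have q: "0 \<le> ?q" by (rule pos_semidef_nonneg[OF psd])
    have gm: "0 < g m m" using Suc.prems(2) by simp
    have D: "0 \<le> ?D" "?D \<le> (\<Prod>i<m. g i i)" using det_pos_semidef_bounds[OF psd] by auto
    have eq: "?D * (g m m - ?q) = (\<Prod>i<m. g i i) * g m m"
      using regular(2) Suc.prems(3) by simp
    have "(\<Prod>i<m. g i i) * g m m \<le> ?D * g m m"
      unfolding eq[symmetric] using D(1) q by (intro mult_left_mono) auto
    then have D': "?D = (\<Prod>i<m. g i i)"
      using gm D(2) by simp
    have "g m m - ?q = g m m"
      using eq mult_left_cancel[OF less_imp_neq[OF pos, symmetric], of m] unfolding D' by simp
    then have "?q = 0" by simp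
    \<comment> \<open>The block sends \<open>x\<close> to the last column, and \<open>x\<close> is
      now in its kernel.\<close>
    then have last: "g i m = 0" if "i < m" for i
      using pos_semidef_kernel[OF psd _ that] regular(1)[OF that] by simp
    have "g m i = 0" if "i < m" for i
      using last[OF that] Suc.prems(1) that by (auto simp: pos_semidef_def)
    then show ?thesis
      using Suc.IH[OF psd _ D'] Suc.prems(2,4-6) last by (metis less_Suc_eq)
  qed
qed

section \<open>Gram determinants of rows\<close>

text \<open>The form at \<open>x\<close> is the squared norm of the combination of the rows
  \<open>r i\<close> with coefficients \<open>x i\<close>.\<close>

lemma pos_semidef_Gram:
  "pos_semidef m (\<lambda>i j. \<Sum>k<n. r i k * r j k)"
  unfolding pos_semidef_def
proof (intro conjI allI impI)
  fix x
  have "(\<Sum>j<m. (\<Sum>k<n. r i k * r j k) * x j) = (\<Sum>k<n. r i k * (\<Sum>j<m. x j * r j k))" for i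
    by (simp add: sum_distrib_left sum_distrib_right sum.swap[of _ "{..<m}"] mult_ac)
  then have "(\<Sum>i<m. x i * (\<Sum>j<m. (\<Sum>k<n. r i k * r j k) * x j)) =
      (\<Sum>i<m. \<Sum>k<n. x i * r i k * (\<Sum>j<m. x j * r j k))"
    by (simp add: sum_distrib_left mult.assoc)
  also have "\<dots> = (\<Sum>k<n. (\<Sum>j<m. x j * r j k)\<^sup>2)"
    by (subst sum.swap) (simp add: sum_distrib_right power2_eq_square)
  finally show "0 \<le> (\<Sum>i<m. x i * (\<Sum>j<m. (\<Sum>k<n. r i k * r j k) * x j))"
    by (simp add: sum_nonneg)
qed (simp add: mult.commute)

lemma sum_minors_squared:
  fixes A :: "real mat"
  assumes A: "A \<in> carrier_mat n n" and I: "I \<subseteq> {..<n}" "card I = m"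
  shows "(\<Sum>J | J \<subseteq> {..<n} \<and> card J = m. (det (submatrix A I J))\<^sup>2) =
    det (mat m m (\<lambda>(i, j). \<Sum>k<n. A $$ (pick I i, k) * A $$ (pick I j, k)))"
proof -
  have I': "{i. i < n \<and> i \<in> I} = I" using I by auto
  \<comment> \<open>The rows of \<open>A\<close> chosen by \<open>I\<close>, renumbered from
    \<open>0\<close>; Cauchy-Binet is applied to \<open>R\<close> and its transpose.\<close>
  define R where "R = mat m n (\<lambda>(i, k). A $$ (pick I i, k))"
  have R: "R \<in> carrier_mat m n" by (simp add: R_def)
  have "mat m m (\<lambda>(i, j). \<Sum>k<n. A $$ (pick I i, k) * A $$ (pick I j, k)) = R * transpose_mat R"
    by (rule eq_matI) (auto simp: R_def scalar_prod_def lessThan_atLeast0)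
  then have "det (mat m m (\<lambda>(i, j). \<Sum>k<n. A $$ (pick I i, k) * A $$ (pick I j, k))) =
      (\<Sum>J | J \<subseteq> {..<n} \<and> card J = m.
        det (submatrix R UNIV J) * det (submatrix (transpose_mat R) J UNIV))"
    using cauchy_binet[OF R, of "transpose_mat R"] R by simp
  also have "\<dots> = (\<Sum>J | J \<subseteq> {..<n} \<and> card J = m. (det (submatrix A I J))\<^sup>2)"
  proof (rule sum.cong[OF refl])
    fix J assume "J \<in> {J. J \<subseteq> {..<n} \<and> card J = m}"
    then have J: "J \<subseteq> {..<n}" "card J = m" by auto
    have J': "{i. i < n \<and> i \<in> J} = J" using J by auto
    have pick: "pick J j < n" if "j < m" for j
      using J that pick_in_set_le[of j J] by auto
    have 1: "submatrix R UNIV J = submatrix A I J"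
      using A I I' J J' pick by (intro eq_matI) (auto simp: submatrix_def R_def pick_UNIV)
    have 2: "submatrix (transpose_mat R) J UNIV = transpose_mat (submatrix A I J)"
      using A I I' J J' pick by (intro eq_matI) (auto simp: submatrix_def R_def pick_UNIV)
    have "submatrix A I J \<in> carrier_mat m m"
      using A I I' J J' by (auto simp: dim_submatrix)
    then show "det (submatrix R UNIV J) * det (submatrix (transpose_mat R) J UNIV) =
        (det (submatrix A I J))\<^sup>2"
      unfolding 1 2 by (simp add: det_transpose power2_eq_square)
  qed
  finally show ?thesis by simp
qed

section \<open>Averaging the Gram determinants over all row sets\<close>

theorem theorem1:
  fixes n m :: nat and A :: "real mat"
  assumes "n \<ge> m" and "m > 1"
    and "sign_matrix n A"
  shows "mean_det_squared n m A \<le> real n ^ m / real (n choose m) \<and>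
    (mean_det_squared n m A = real n ^ m / real (n choose m) \<longleftrightarrow> hadamard_matrix n A)"
proof -
  let ?S = "{I. I \<subseteq> {..<n} \<and> card I = m}"
  define c where "c i j = (\<Sum>k<n. A $$ (i, k) * A $$ (j, k))" for i j
  define G where "G I = det (mat m m (\<lambda>(i, j). c (pick I i) (pick I j)))" for I
  have A: "A \<in> carrier_mat n n" using assms(3) by (simp add: sign_matrix_def)
  have diag: "c i i = real n" if "i < n" for i
  proof -
    have "c i i = (\<Sum>k<n. 1)"
      unfolding c_def using assms(3) that by (intro sum.cong) (fastforce simp: sign_matrix_def)+
    then show ?thesis by simp
  qed
  have hadamard: "hadamard_matrix n A \<longleftrightarrow> (\<forall>i<n. \<forall>j<n. i \<noteq> j \<longrightarrow> c i j = 0)"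
  proof -
    have "A * transpose_mat A = mat n n (\<lambda>(i, j). c i j)"
      using A by (intro eq_matI) (auto simp: c_def scalar_prod_def lessThan_atLeast0)
    then have "hadamard_matrix n A \<longleftrightarrow> mat n n (\<lambda>(i, j). c i j) = real n \<cdot>\<^sub>m 1\<^sub>m n"
      using assms(3) by (simp add: hadamard_matrix_def)
    also have "\<dots> \<longleftrightarrow> (\<forall>i<n. \<forall>j<n. c i j = (if i = j then real n else 0))"
      by (auto simp: mat_eq_iff)
    finally show ?thesis using diag by auto
  qed
  have pick: "pick I i < n" if "I \<in> ?S" "i < m" for I i
    using that pick_in_set_le[of i I] by auto
  have fin: "finite ?S" by simp
  have psd: "pos_semidef m (\<lambda>i j. c (pick I i) (pick I j))" for I
    unfolding c_def by (rule pos_semidef_Gram)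
  have prod: "(\<Prod>i<m. c (pick I i) (pick I i)) = real n ^ m" if "I \<in> ?S" for I
    using diag pick[OF that] by simp
  have G_le: "G I \<le> real n ^ m" if "I \<in> ?S" for I
    using det_pos_semidef_bounds(2)[OF psd, of I] prod[OF that] by (simp add: G_def)
  have G_eq: "(\<forall>I\<in>?S. G I = real n ^ m) \<longleftrightarrow> hadamard_matrix n A"
  proof
    assume G: "\<forall>I\<in>?S. G I = real n ^ m"
    have "c i j = 0" if ij: "i < n" "j < n" "i \<noteq> j" for i j
    proof -
      \<comment> \<open>Two distinct indices extend to a row set of size \<open>m\<close> because
        \<open>2 \<le> m \<le> n\<close>.\<close>
      obtain I where I: "{i, j} \<subseteq> I" "I \<subseteq> {..<n}" "card I = m"
        using exists_subset_between[of "{i, j}" m "{..<n}"] ij assms(1,2) by auto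
      then have bij: "bij_betw (pick I) {..<m} I"
        using bij_betw_pick[of I] finite_subset by blast
      have "i \<in> pick I ` {..<m}" "j \<in> pick I ` {..<m}"
        using bij I(1) by (auto simp: bij_betw_def)
      then obtain k l where kl: "k < m" "l < m" "i = pick I k" "j = pick I l"
        by blast
      have "G I = (\<Prod>i<m. c (pick I i) (pick I i))"
        using G I(2,3) prod by auto
      moreover have "0 < c (pick I i) (pick I i)" if "i < m" for i
        using diag pick[of I i] I that assms(1,2) by auto
      ultimately show ?thesis
        using det_pos_semidef_eq_prod_diag[OF psd, of I k l] kl ij(3) by (auto simp: G_def)
    qed
    then show "hadamard_matrix n A" using hadamard by blast
  next
    assume "hadamard_matrix n A"
    then have c: "c i j = (if i = j then real n else 0)" if "i < n" "j < n" for i j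
      using hadamard diag that by auto
    show "\<forall>I\<in>?S. G I = real n ^ m"
    proof
      fix I assume I: "I \<in> ?S"
      then have "finite I" using finite_subset by blast
      then have "inj_on (pick I) {..<m}"
        using bij_betw_pick[of I] I by (auto simp: bij_betw_def)
      \<comment> \<open>Injectivity of \<open>pick I\<close> keeps off-diagonal positions off the
        diagonal of \<open>c\<close>.\<close>
      then have "mat m m (\<lambda>(i, j). c (pick I i) (pick I j)) = real n \<cdot>\<^sub>m 1\<^sub>m m"
        using pick[OF I] by (intro eq_matI) (auto simp: c inj_on_eq_iff)
      then show "G I = real n ^ m" by (simp add: G_def)
    qed
  qed
  have "(\<Sum>(I, J)\<in>submatrix_indices n m. (det (submatrix A I J))\<^sup>2) = (\<Sum>I\<in>?S. G I)"
    unfolding submatrix_indices_def sum.cartesian_product[symmetric]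
    by (rule sum.cong[OF refl]) (use sum_minors_squared[OF A] in \<open>auto simp: G_def c_def\<close>)
  then have mean: "mean_det_squared n m A = (\<Sum>I\<in>?S. G I) / (real (n choose m))\<^sup>2"
    by (simp add: mean_det_squared_def card_submatrix_indices)
  have card: "card ?S = n choose m" using n_subsets[of "{..<n}" m] by simp
  have pos: "0 < real (n choose m)" using assms(1) by simp
  \<comment> \<open>Written as a constant sum over the same row sets and denominator, the bound can
    be compared with the mean term by term.\<close>
  have bound: "real n ^ m / real (n choose m) = (\<Sum>I\<in>?S. real n ^ m) / (real (n choose m))\<^sup>2"
    using pos card by (simp add: power2_eq_square)
  have "(\<Sum>I\<in>?S. G I) \<le> (\<Sum>I\<in>?S. real n ^ m)"
    by (rule sum_mono) (rule G_le)
  moreover have "(\<Sum>I\<in>?S. G I) = (\<Sum>I\<in>?S. real n ^ m) \<longleftrightarrow> (\<forall>I\<in>?S. G I = real n ^ m)"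
  proof
    assume eq: "(\<Sum>I\<in>?S. G I) = (\<Sum>I\<in>?S. real n ^ m)"
    show "\<forall>I\<in>?S. G I = real n ^ m"
      using sum_mono_inv[OF eq G_le _ fin] by blast
  qed simp
  ultimately show ?thesis
    unfolding mean bound G_eq[symmetric] using pos by (simp add: divide_right_mono)
qed

end
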